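(* Let $\Phi:(S,\cdot)\to(T,\cdot)$ be a semigroup homomorphism such that $\Phi(S)$ is piecewise syndetic in $T$. If $A\subseteq S$ is piecewise syndetic in $S$, then $\Phi(A)$ is piecewise syndetic in $T$.
   Context: For a semigroup $(X,\cdot)$, $B\subseteq X$ and $x\in X$, let $x^{-1}B=\{y\in X: x\cdot y\in B\}$; $\mathcal P_f(X)$ denotes the set of finite nonempty subsets of $X$. A set $B\subseteq X$ is piecewise syndetic in $X$ if there exists $G\in\mathcal P_f(X)$ such that for every $F\in\mathcal P_f(X)$ there exists $x\in X$ with $F\cdot x\subseteq\bigcup_{t\in G}t^{-1}B$. *)

theory Defs
  imports Main
begin

definition left_preimage :: "'a::semigroup_mult \<Rightarrow> 'a set \<Rightarrow> 'a set"
  where "left_preimage x B = {y. x * y \<in> B}"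

definition piecewise_syndetic :: "'a::semigroup_mult set \<Rightarrow> bool"
  where "piecewise_syndetic B \<longleftrightarrow>
    (\<exists>G. finite G \<and> G \<noteq> {} \<and>
      (\<forall>F. finite F \<and> F \<noteq> {} \<longrightarrow>
        (\<exists>x. (\<lambda>f. f * x) ` F \<subseteq> (\<Union>t\<in>G. left_preimage t B))))"

end

theory Submission
  imports Defs
begin

text \<open>Two shifts are composed. Given a finite F in the target, piecewise syndeticity of the
  range gives one x such that every f * x, multiplied on the left by some t in \<open>H\<close>,
  becomes a value \<Phi> s. The finitely many s so obtained are then shifted by one y in the source,
  so that some g in \<open>G\<close> brings each s * y into \<open>A\<close>. Applying \<Phi> and
  reassociating, \<Phi> g * t carries f * (x * \<Phi> y) into the image of \<open>A\<close>.\<close>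

theorem theorem3p1:
  fixes \<Phi> :: "'s::semigroup_mult \<Rightarrow> 't::semigroup_mult" and A :: "'s set"
  assumes hom: "\<And>x y. \<Phi> (x * y) = \<Phi> x * \<Phi> y"
    and range_ps: "piecewise_syndetic (range \<Phi>)"
    and A_ps: "piecewise_syndetic A"
  shows "piecewise_syndetic (\<Phi> ` A)"
proof -
  obtain H where H: "finite H" "H \<noteq> {}"
    and range_shift: "\<And>F. finite F \<Longrightarrow> F \<noteq> {} \<Longrightarrow> \<exists>x. \<forall>f\<in>F. \<exists>t\<in>H. t * (f * x) \<in> range \<Phi>"
    using range_ps unfolding piecewise_syndetic_def left_preimage_def
    by (force simp: image_subset_iff)
  obtain G where G: "finite G" "G \<noteq> {}"
    and A_shift: "\<And>F. finite F \<Longrightarrow> F \<noteq> {} \<Longrightarrow> \<exists>y. \<forall>f\<in>F. \<exists>g\<in>G. g * (f * y) \<in> A"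
    using A_ps unfolding piecewise_syndetic_def left_preimage_def
    by (force simp: image_subset_iff)
  \<comment> \<open>The products \<Phi> g * t are the only left multipliers that occur, so this
    finite set is fixed before F is given.\<close>
  define K where "K = (\<lambda>(g, t). \<Phi> g * t) ` (G \<times> H)"
  have "\<exists>z. (\<lambda>f. f * z) ` F \<subseteq> (\<Union>k\<in>K. left_preimage k (\<Phi> ` A))"
    if F: "finite F" "F \<noteq> {}" for F
  proof -
    obtain x where "\<forall>f\<in>F. \<exists>t\<in>H. \<exists>s. t * (f * x) = \<Phi> s"
      using range_shift[OF F] by (auto simp: image_iff)
    \<comment> \<open>Arbitrary choices of a multiplier and of a preimage under \<Phi> for each f;
      no algebraic property of \<open>s\<close> is required.\<close>
    then obtain t s where ts: "\<And>f. f \<in> F \<Longrightarrow> t f \<in> H \<and> t f * (f * x) = \<Phi> (s f)"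
      by metis
    obtain y where y: "\<forall>f\<in>F. \<exists>g\<in>G. g * (s f * y) \<in> A"
      using A_shift[of "s ` F"] F by auto
    \<comment> \<open>The witness for the shift is x * \<Phi> y, which does not depend on f.\<close>
    have "f * (x * \<Phi> y) \<in> (\<Union>k\<in>K. left_preimage k (\<Phi> ` A))" if f: "f \<in> F" for f
    proof -
      obtain g where g: "g \<in> G" "g * (s f * y) \<in> A"
        using y f by blast
      have "(\<Phi> g * t f) * (f * (x * \<Phi> y)) = \<Phi> g * ((t f * (f * x)) * \<Phi> y)"
        by (simp add: mult.assoc)
      also have "\<dots> = \<Phi> (g * (s f * y))"
        using ts[OF f] by (simp add: hom)
      finally have "f * (x * \<Phi> y) \<in> left_preimage (\<Phi> g * t f) (\<Phi> ` A)"
        using g(2) by (simp add: left_preimage_def)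
      moreover have "\<Phi> g * t f \<in> K"
        using g(1) ts[OF f] by (force simp: K_def)
      ultimately show ?thesis
        by blast
    qed
    then show ?thesis
      by blast
  qed
  moreover have "finite K" "K \<noteq> {}"
    using G H by (auto simp: K_def)
  ultimately show ?thesis
    unfolding piecewise_syndetic_def by blast
qed

end
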